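(* Let $(\mathcal F,\partial,\int)$ be an ordinary shifted integro-differential algebra over an ordered field $K$. Then the distribution module $(\mathcal D\mathcal F,D,I)$ is an ordinary integro-differential module over $\mathcal F$.
   Context: All algebras are commutative and unital; $[P,Q]=PQ-QP$. **Heaviside operator.** $H\colon K\to K$ is $H(a)=0$ for $a\le 0$ and $H(a)=1$ for $a>0$; $\bar H(a)=1-H(a)$. **Integro-differential algebra.** $(\mathcal F,\partial,\int)$ is a differential $K$-algebra with a $K$-linear map $\int$ such that $\partial\int=1$ and $f\int g=\int fg+\int(f'\int g)$. It is ordinary if $\ker\partial=K$; then $\mathsf e:=1-\int\partial$ is a $K$-algebra homomorphism $\mathcal F\to K$. It is shifted if there is a group homomorphism $S\colon(K,+)\to\operatorname{Aut}_K(\mathcal F)$, $c\mapsto S_c$, with $[S_c,\int]=\mathsf e_c\int$ and $[S_c,\partial]=0$, where $\mathsf e_c:=\mathsf e\circ S_c$. Set $\int_c:=(1-\mathsf e_c)\int$, $\int_c^d:=\mathsf e_d\int_c$. **Distribution module.** Let $\mathcal F\{H_a\mid a\in K\}_1$ be the free $\mathcal F$-module on $1$ and all $H_a^{(k)}$ $(a\in K,k\ge 0)$, with derivation extending $\partial$, sending $H_a^{(k)}\mapsto H_a^{(k+1)}$ and obeying the Leibniz rule over $\mathcal F$. Put $\delta_a:=H_a'$ and let $Z$ be the differential $\mathcal F$-submodule generated by all $f\delta_a-\mathsf e_a(f)\delta_a$ $(f\in\mathcal F,a\in K)$. Then $\mathcal D\mathcal F:=\mathcal F\{H_a\mid a\in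 K\}_1/Z$, $D$ is the induced derivation, and $I\colon\mathcal D\mathcal F\to\mathcal D\mathcal F$ is the (well-defined) $K$-linear map with $$I(f)=\int f,\qquad I(fH_a)=\Big(\int_af\Big)H_a+\bar H(a)\int_0^af,$$ $$I(f\delta_a)=\mathsf e_a(f)\big(H_a-\bar H(a)\big),\qquad I(f\delta_a^{(k)})=f\delta_a^{(k-1)}-I(f'\delta_a^{(k-1)})\quad(k>0).$$ **Modules.** A differential Rota-Baxter module $(M,D,I)$ over $(\mathcal F,\partial,\int)$ is an $\mathcal F$-module $M$ with $K$-linear maps $D,I$ satisfying $D(f\phi)=(\partial f)\phi+f\,D\phi$, $(\int f)\cdot I\phi=I(f\,I\phi)+I((\int f)\phi)$ and $D\circ I=1_M$. It is an integro-differential module if $\mathsf E:=1_M-I\circ D$ satisfies $\mathsf E(f\phi)=\mathsf e(f)\,\mathsf E(\phi)$ for all $f\in\mathcal F$, $\phi\in M$, where $\mathsf e=1-\int\partial$. It is ordinary if $\ker D=K$ (for $M=\mathcal D\mathcal F$, $K\subset\mathcal F\subset\mathcal D\mathcal F$). *)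

theory Defs
  imports "HOL-Algebra.Algebraic_Closure_Type" "HOL-Library.Poly_Mapping"
begin

section \<open>Integro-differential algebras\<close>

text \<open>
  A unital commutative algebra over a field is given by a type of class \<open>comm_ring_1\<close> together
  with a scalar multiplication. The field embeds through \<open>c \<mapsto> scale c 1\<close>, and
  scalars are identified with their images under this embedding.
\<close>

locale commutative_algebra = Vector_Spaces.vector_space scale
  for scale :: "'k::field \<Rightarrow> 'f::comm_ring_1 \<Rightarrow> 'f" +
  assumes scale_mult: "scale c (f * g) = scale c f * g"

locale differential_algebra = commutative_algebra scale
  for scale :: "'k::field \<Rightarrow> 'f::comm_ring_1 \<Rightarrow> 'f" +
  fixes der :: "'f \<Rightarrow> 'f"
  assumes linear_der: "Vector_Spaces.linear scale scale der"
    and leibniz: "der (f * g) = der f * g + f * der g"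

locale integro_differential_algebra = differential_algebra scale der
  for scale :: "'k::field \<Rightarrow> 'f::comm_ring_1 \<Rightarrow> 'f" and der :: "'f \<Rightarrow> 'f" +
  fixes integ :: "'f \<Rightarrow> 'f"
  assumes linear_integ: "Vector_Spaces.linear scale scale integ"
    and der_integ: "der (integ f) = f"
    and integ_by_parts: "f * integ g = integ (f * g) + integ (der f * integ g)"

locale ordinary_integro_differential_algebra = integro_differential_algebra scale der integ
  for scale :: "'k::field \<Rightarrow> 'f::comm_ring_1 \<Rightarrow> 'f" and der integ :: "'f \<Rightarrow> 'f" +
  assumes kernel_der: "{f. der f = 0} = range (\<lambda>c. scale c 1)"

text \<open>
  The evaluation \<open>ev\<close> is \<open>1 - \<integral>\<partial>\<close>. In the ordinary case its
  values are scalars; they are kept as elements of the algebra.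
\<close>

definition ev :: "('f::comm_ring_1 \<Rightarrow> 'f) \<Rightarrow> ('f \<Rightarrow> 'f) \<Rightarrow> 'f \<Rightarrow> 'f" where
  "ev der integ f = f - integ (der f)"

definition algebra_aut ::
  "('k::field \<Rightarrow> 'f::comm_ring_1 \<Rightarrow> 'f) \<Rightarrow> ('f \<Rightarrow> 'f) \<Rightarrow> bool" where
  "algebra_aut scale \<sigma> \<longleftrightarrow>
     Vector_Spaces.linear scale scale \<sigma> \<and> \<sigma> 1 = 1 \<and>
     (\<forall>f g. \<sigma> (f * g) = \<sigma> f * \<sigma> g) \<and> bij \<sigma>"

locale shifted_integro_differential_algebra = integro_differential_algebra scale der integ
  for scale :: "'k::field \<Rightarrow> 'f::comm_ring_1 \<Rightarrow> 'f" and der integ :: "'f \<Rightarrow> 'f" +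
  fixes S :: "'k \<Rightarrow> 'f \<Rightarrow> 'f"
  assumes aut_shift: "algebra_aut scale (S c)"
    and shift_add: "S (c + d) = S c \<circ> S d"
    and shift_integ: "S c (integ f) - integ (S c f) = ev der integ (S c (integ f))"
    and shift_der: "S c (der f) - der (S c f) = 0"


section \<open>Integro-differential modules\<close>

text \<open>
  Modules have explicit carriers, since the distribution module is a quotient depending on the
  structure of the base algebra.
\<close>

locale differential_rota_baxter_module =
  base: integro_differential_algebra scale der integ +
  Module.module "ring_of_type_algebra :: 'f ring" M
  for scale :: "'k::field \<Rightarrow> 'f::comm_ring_1 \<Rightarrow> 'f" and der integ :: "'f \<Rightarrow> 'f"
    and M :: "('f, 'm, 'z) module_scheme" (structure) +
  fixes D I :: "'m \<Rightarrow> 'm"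
  assumes D_closed: "D \<in> carrier M \<rightarrow> carrier M"
    and D_add: "\<lbrakk>\<phi> \<in> carrier M; \<psi> \<in> carrier M\<rbrakk> \<Longrightarrow> D (\<phi> \<oplus> \<psi>) = D \<phi> \<oplus> D \<psi>"
    and D_scale: "\<phi> \<in> carrier M \<Longrightarrow> D (scale c 1 \<odot> \<phi>) = scale c 1 \<odot> D \<phi>"
    and I_closed: "I \<in> carrier M \<rightarrow> carrier M"
    and I_add: "\<lbrakk>\<phi> \<in> carrier M; \<psi> \<in> carrier M\<rbrakk> \<Longrightarrow> I (\<phi> \<oplus> \<psi>) = I \<phi> \<oplus> I \<psi>"
    and I_scale: "\<phi> \<in> carrier M \<Longrightarrow> I (scale c 1 \<odot> \<phi>) = scale c 1 \<odot> I \<phi>"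
    and D_smult: "\<phi> \<in> carrier M \<Longrightarrow> D (f \<odot> \<phi>) = der f \<odot> \<phi> \<oplus> f \<odot> D \<phi>"
    and rota_baxter:
      "\<phi> \<in> carrier M \<Longrightarrow> integ f \<odot> I \<phi> = I (f \<odot> I \<phi>) \<oplus> I (integ f \<odot> \<phi>)"
    and D_I: "\<phi> \<in> carrier M \<Longrightarrow> D (I \<phi>) = \<phi>"
begin

definition E :: "'m \<Rightarrow> 'm" where
  "E \<phi> = \<phi> \<ominus> I (D \<phi>)"

end

locale integro_differential_module = differential_rota_baxter_module +
  assumes E_smult: "\<phi> \<in> carrier M \<Longrightarrow> E (f \<odot> \<phi>) = ev der integ f \<odot> E \<phi>"

text \<open>Here \<open>\<iota>\<close> is the inclusion of the ground field into the module.\<close>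

locale ordinary_integro_differential_module =
  integro_differential_module scale der integ M D I
  for scale :: "'k::field \<Rightarrow> 'f::comm_ring_1 \<Rightarrow> 'f" and der integ :: "'f \<Rightarrow> 'f"
    and M :: "('f, 'm, 'z) module_scheme" (structure) and D I :: "'m \<Rightarrow> 'm" +
  fixes \<iota> :: "'k \<Rightarrow> 'm"
  assumes kernel_D: "{\<phi> \<in> carrier M. D \<phi> = \<zero>} = range \<iota>"


section \<open>The distribution module\<close>

definition heaviside :: "'k::linordered_field \<Rightarrow> 'k" where
  "heaviside a = (if a \<le> 0 then 0 else 1)"

definition heaviside_bar :: "'k::linordered_field \<Rightarrow> 'k" where
  "heaviside_bar a = 1 - heaviside a"

text \<open>
  Basis of the free module: \<open>One\<close> is the basis element \<open>1\<close> and \<open>Hvs a k\<close> is the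
  \<open>k\<close>-th derivative of \<open>H\<^sub>a\<close>, so that \<open>\<delta>\<^sub>a\<close> is \<open>Hvs a 1\<close>
  and \<open>\<delta>\<^sub>a\<close> differentiated \<open>k\<close> times is \<open>Hvs a (Suc k)\<close>. The element
  \<open>f b\<close> of the free module is \<open>Poly_Mapping.single b f\<close>.
\<close>

datatype 'k dist_basis = One | Hvs 'k nat

type_synonym ('k, 'f) predist = "'k dist_basis \<Rightarrow>\<^sub>0 'f"

definition predist_smult :: "'f::comm_ring_1 \<Rightarrow> ('k, 'f) predist \<Rightarrow> ('k, 'f) predist" where
  "predist_smult f = Poly_Mapping.map ((*) f)"

lemma lookup_predist_smult [simp]:
  "Poly_Mapping.lookup (predist_smult f x) b = f * Poly_Mapping.lookup x b"
  by (simp add: predist_smult_def Poly_Mapping.map.rep_eq when_def)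

lemma module_predist_smult:
  "Modules.module (predist_smult :: 'f::comm_ring_1 \<Rightarrow> ('k, 'f) predist \<Rightarrow> _)"
  by unfold_locales (auto intro!: poly_mapping_eqI simp: lookup_add algebra_simps)

fun predist_der_term ::
  "('f::comm_ring_1 \<Rightarrow> 'f) \<Rightarrow> 'k dist_basis \<Rightarrow> 'f \<Rightarrow> ('k, 'f) predist" where
  "predist_der_term der One f = Poly_Mapping.single One (der f)"
| "predist_der_term der (Hvs a k) f =
     Poly_Mapping.single (Hvs a k) (der f) + Poly_Mapping.single (Hvs a (Suc k)) f"

definition predist_der ::
  "('f::comm_ring_1 \<Rightarrow> 'f) \<Rightarrow> ('k, 'f) predist \<Rightarrow> ('k, 'f) predist" where
  "predist_der der x =
     (\<Sum>b\<in>Poly_Mapping.keys x. predist_der_term der b (Poly_Mapping.lookup x b))"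

context
  fixes scale :: "'k::linordered_field \<Rightarrow> 'f::comm_ring_1 \<Rightarrow> 'f"
    and der integ :: "'f \<Rightarrow> 'f" and S :: "'k \<Rightarrow> 'f \<Rightarrow> 'f"
begin

definition ev_at :: "'k \<Rightarrow> 'f \<Rightarrow> 'f" where
  "ev_at c f = ev der integ (S c f)"

definition integ_from :: "'k \<Rightarrow> 'f \<Rightarrow> 'f" where
  "integ_from c f = integ f - ev_at c (integ f)"

definition integ_from_to :: "'k \<Rightarrow> 'k \<Rightarrow> 'f \<Rightarrow> 'f" where
  "integ_from_to c d f = ev_at d (integ_from c f)"

definition dist_relations :: "('k, 'f) predist set" where
  "dist_relations =
     (\<lambda>N. Modules.module.subspace predist_smult N \<and> predist_der der ` N \<subseteq> N) hull
       {Poly_Mapping.single (Hvs a 1) f - Poly_Mapping.single (Hvs a 1) (ev_at a f) | f a. True}"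

definition dist_class :: "('k, 'f) predist \<Rightarrow> ('k, 'f) predist set" where
  "dist_class x = {x + z | z. z \<in> dist_relations}"

text \<open>
  For an additive \<open>h\<close>, the union over all representatives is again a single class, namely
  that of \<open>h x\<close> for any representative \<open>x\<close>, exactly when \<open>h\<close> maps relations to
  relations. Hence closure of the carrier under \<open>D\<close> and \<open>I\<close> contains their
  well-definedness.
\<close>

definition dist_lift ::
  "(('k, 'f) predist \<Rightarrow> ('k, 'f) predist) \<Rightarrow> ('k, 'f) predist set \<Rightarrow> ('k, 'f) predist set"
  where "dist_lift h A = (\<Union>x\<in>A. dist_class (h x))"

text \<open>The ring operations required by the record type play no role for a module.\<close>

definition dist_module :: "('f, ('k, 'f) predist set) module" where
  "dist_module =
     \<lparr>carrier = range dist_class,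
      monoid.mult = undefined, one = undefined,
      zero = dist_class 0,
      add = (\<lambda>A B. \<Union>x\<in>A. \<Union>y\<in>B. dist_class (x + y)),
      module.smult = (\<lambda>f. dist_lift (predist_smult f))\<rparr>"

definition dist_of :: "'f \<Rightarrow> ('k, 'f) predist set" where
  "dist_of f = dist_class (Poly_Mapping.single One f)"

definition dist_der :: "('k, 'f) predist set \<Rightarrow> ('k, 'f) predist set" where
  "dist_der = dist_lift (predist_der der)"

text \<open>The base algebra, hence also the ground field, is contained in the distribution module.\<close>

lemma inj_dist_of: "inj dist_of"
proof (rule injI)
  fix f g assume eq: "dist_of f = dist_of g"
  let ?N = "{x :: ('k, 'f) predist. Poly_Mapping.lookup x One = 0}"
  have der0: "Poly_Mapping.lookup (predist_der der x) One = 0" if "x \<in> ?N" for x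
  proof -
    have "Poly_Mapping.lookup (predist_der_term der b (Poly_Mapping.lookup x b)) One = 0"
      if "b \<in> Poly_Mapping.keys x" for b
      using that \<open>x \<in> ?N\<close>
      by (cases b) (auto simp: lookup_add lookup_single in_keys_iff)
    then show ?thesis
      by (simp add: predist_der_def lookup_sum)
  qed
  have "Modules.module.subspace predist_smult ?N"
    by (auto simp: Modules.module.subspace_def[OF module_predist_smult] lookup_add)
  then have N: "dist_relations \<subseteq> ?N"
    unfolding dist_relations_def using der0
    by (intro hull_minimal) (auto simp: lookup_minus lookup_single)
  have "Modules.module.subspace predist_smult (dist_relations :: ('k, 'f) predist set)"
    unfolding dist_relations_def hull_def
    by (auto simp: Modules.module.subspace_def[OF module_predist_smult])
  then have "0 \<in> (dist_relations :: ('k, 'f) predist set)"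
    by (simp add: Modules.module.subspace_def[OF module_predist_smult])
  then have "Poly_Mapping.single One f \<in> dist_class (Poly_Mapping.single One f)"
    unfolding dist_class_def by force
  then have "Poly_Mapping.single One f \<in> dist_class (Poly_Mapping.single One g)"
    using eq by (simp add: dist_of_def)
  then obtain z where z: "z \<in> dist_relations"
    and fz: "Poly_Mapping.single One f = Poly_Mapping.single One g + z"
    by (auto simp: dist_class_def)
  have "f = g + Poly_Mapping.lookup z One"
    using arg_cong[OF fz, of "\<lambda>x. Poly_Mapping.lookup x One"] by (simp add: lookup_add)
  with z N show "f = g"
    by auto
qed

text \<open>Antiderivative of \<open>f\<close> times the \<open>k\<close>-th derivative of \<open>\<delta>\<^sub>a\<close>.\<close>

primrec predist_integ_delta :: "'k \<Rightarrow> nat \<Rightarrow> 'f \<Rightarrow> ('k, 'f) predist" where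
  "predist_integ_delta a 0 f =
     predist_smult (ev_at a f)
       (Poly_Mapping.single (Hvs a 0) 1 - Poly_Mapping.single One (scale (heaviside_bar a) 1))"
| "predist_integ_delta a (Suc k) f =
     Poly_Mapping.single (Hvs a (Suc k)) f - predist_integ_delta a k (der f)"

fun predist_integ_term :: "'k dist_basis \<Rightarrow> 'f \<Rightarrow> ('k, 'f) predist" where
  "predist_integ_term One f = Poly_Mapping.single One (integ f)"
| "predist_integ_term (Hvs a 0) f =
     Poly_Mapping.single (Hvs a 0) (integ_from a f) +
     Poly_Mapping.single One (scale (heaviside_bar a) (integ_from_to 0 a f))"
| "predist_integ_term (Hvs a (Suc k)) f = predist_integ_delta a k f"

definition predist_integ :: "('k, 'f) predist \<Rightarrow> ('k, 'f) predist" where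
  "predist_integ x =
     (\<Sum>b\<in>Poly_Mapping.keys x. predist_integ_term b (Poly_Mapping.lookup x b))"

definition dist_integ :: "('k, 'f) predist set \<Rightarrow> ('k, 'f) predist set" where
  "dist_integ = dist_lift predist_integ"

end

end

theory Submission
  imports Defs
begin

text \<open>
  The whole proof happens on representatives in the free module. Write \<open>D\<close> and \<open>I\<close> for
  the derivation and the integral there, and \<open>B = 1 - I D\<close> for the boundary operator. A
  computation on monomials shows that \<open>B\<close> is extremely simple, and that the formulas hold on
  the nose, before any relation is imposed: \<open>B f = f(0)\<close>, \<open>B (f H\<^sub>a) = f(0) H\<^sub>a(0)\<close>, and \<open>B\<close>
  kills everything supported on the deltas. Here \<open>f(a)\<close> stands for the evaluation of \<open>f\<close> at
  \<open>a\<close>, and \<open>H\<^sub>a(0)\<close> for \<open>1 - H(a)\<close>. So \<open>B\<close> is evaluation at \<open>0\<close>; its values are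
  scalars (\<open>boundary_scalar\<close>), and \<open>B (f x) = f(0) B x\<close> (\<open>boundary_smult\<close>) because evaluation is
  multiplicative on the base algebra (\<open>ev_mult\<close>).

  These facts do nearly all the work.

  \<^item> Well-definedness of \<open>I\<close>: if \<open>z\<close> is a combination of deltas, then so is \<open>f z\<close>, hence
    \<open>B (f z) = 0\<close>, which by the Leibniz rule is integration by parts
    \<open>I (f D z) = f z - I (f' z)\<close>. So if \<open>z\<close> is a relation and \<open>I\<close> maps all
    its multiples to relations, then the same is true of \<open>D z\<close>; and all multiples of the generating
    relations are integrated to \<open>0\<close>
    (\<open>integ_relations\<close>).

  \<^item> \<open>D I = 1\<close> holds modulo relations, again by inspecting monomials
    (\<open>der_integ_predist\<close>).

  \<^item> The Rota-Baxter axiom is a consequence. Modulo relations, the difference \<open>d\<close> of its two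
    sides is killed by \<open>D\<close> because \<open>D I = 1\<close>, and by \<open>B\<close> because \<open>B I = 0\<close> and
    \<open>B ((\<integral>f) x) = (\<integral>f)(0) B x = 0\<close>. Therefore \<open>d = B d + I D d = 0\<close>
    (\<open>rota_baxter_predist\<close>).

  \<^item> Ordinariness: if \<open>D x = 0\<close> modulo relations, then \<open>x = B x\<close> is a scalar (\<open>kernel_dist_der\<close>).
\<close>

section \<open>Additive maps on a free module\<close>

lemma single_sum_induct [case_names single add]:
  fixes x :: "'b \<Rightarrow>\<^sub>0 'f::comm_monoid_add"
  assumes single: "\<And>b f. P (Poly_Mapping.single b f)"
    and add: "\<And>x y. P x \<Longrightarrow> P y \<Longrightarrow> P (x + y)"
  shows "P x"
proof (induction x rule: update_induct)
  case const
  \<comment> \<open>zero is the monomial with coefficient zero, at whatever basis element\<close>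
  show ?case
    using single[of undefined 0] by simp
next
  case (update x b f)
  have "Poly_Mapping.update b f x = x + Poly_Mapping.single b f"
    using update(1)
    by (intro poly_mapping_eqI)
      (auto simp: lookup_update lookup_add lookup_single when_def in_keys_iff)
  then show ?case
    using add[OF update(3) single] by simp
qed

text \<open>
  The derivation and the integral of the free module are given by a sum over the support of their
  argument. Additivity is not immediate, since supports may shrink under addition; as the terms
  vanish for coefficient zero, both sides can be taken over the union of the supports.
\<close>

lemma sum_keys_add:
  fixes T :: "'b \<Rightarrow> 'f::comm_monoid_add \<Rightarrow> 'c::cancel_comm_monoid_add"
  assumes T: "\<And>b f g. T b (f + g) = T b f + T b g"
  shows "(\<Sum>b\<in>Poly_Mapping.keys (x + y). T b (Poly_Mapping.lookup (x + y) b)) =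
    (\<Sum>b\<in>Poly_Mapping.keys x. T b (Poly_Mapping.lookup x b)) +
    (\<Sum>b\<in>Poly_Mapping.keys y. T b (Poly_Mapping.lookup y b))"
proof -
  let ?B = "Poly_Mapping.keys x \<union> Poly_Mapping.keys y"
  have T0: "T b 0 = 0" for b
    using T[of b 0 0] by simp
  have ext: "(\<Sum>b\<in>Poly_Mapping.keys z. T b (Poly_Mapping.lookup z b)) =
      (\<Sum>b\<in>?B. T b (Poly_Mapping.lookup z b))" if "Poly_Mapping.keys z \<subseteq> ?B" for z
    using that by (intro sum.mono_neutral_left) (auto simp: in_keys_iff T0)
  have "Poly_Mapping.keys (x + y) \<subseteq> ?B"
    by (rule Poly_Mapping.keys_add)
  then show ?thesis
    using ext[of "x + y"] ext[of x] ext[of y] by (simp add: lookup_add T sum.distrib)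
qed

lemma sum_keys_single:
  assumes "T b 0 = 0"
  shows "(\<Sum>c\<in>Poly_Mapping.keys (Poly_Mapping.single b f).
    T c (Poly_Mapping.lookup (Poly_Mapping.single b f) c)) = T b f"
  using assms by (simp add: keys_single)

section \<open>The quotient by the relations\<close>

interpretation predist: Modules.module predist_smult
  by (rule module_predist_smult)

lemma predist_smult_single [simp]:
  "predist_smult f (Poly_Mapping.single b g) = Poly_Mapping.single b (f * g)"
  by (rule poly_mapping_eqI) (simp add: lookup_single when_def)

lemma dist_relations_closed:
  fixes der integ :: "'f::comm_ring_1 \<Rightarrow> 'f" and S :: "'k::linordered_field \<Rightarrow> 'f \<Rightarrow> 'f"
  shows "predist.subspace (dist_relations der integ S) \<and>
   predist_der der ` dist_relations der integ S \<subseteq> dist_relations der integ S"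
  unfolding dist_relations_def
proof (rule hull_in)
  fix \<N> :: "('k, 'f) predist set set"
  assume "\<forall>N\<in>\<N>. predist.subspace N \<and> predist_der der ` N \<subseteq> N"
  then show "predist.subspace (\<Inter>\<N>) \<and> predist_der der ` \<Inter>\<N> \<subseteq> \<Inter>\<N>"
    by (auto intro!: predist.subspace_Inter)
qed

context
  fixes scale :: "'k::linordered_field \<Rightarrow> 'f::comm_ring_1 \<Rightarrow> 'f"
    and der integ :: "'f \<Rightarrow> 'f" and S :: "'k \<Rightarrow> 'f \<Rightarrow> 'f"
begin

abbreviation (input) "Z \<equiv> dist_relations der integ S"
abbreviation (input) "cls \<equiv> dist_class der integ S"

lemma subspace_dist_relations: "predist.subspace Z"
  using dist_relations_closed by blast

lemma mem_dist_class_iff: "u \<in> cls x \<longleftrightarrow> u - x \<in> Z"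
  by (force simp: dist_class_def)

lemma dist_class_self: "x \<in> cls x"
  using predist.subspace_0[OF subspace_dist_relations] by (simp add: mem_dist_class_iff)

lemma dist_class_eq_iff: "cls x = cls y \<longleftrightarrow> x - y \<in> Z"
proof
  assume eq: "cls x = cls y"
  with dist_class_self[of x] show "x - y \<in> Z"
    by (simp add: mem_dist_class_iff)
next
  assume xy: "x - y \<in> Z"
  have "u - x \<in> Z \<longleftrightarrow> u - y \<in> Z" for u
    using predist.subspace_add[OF subspace_dist_relations xy, of "u - x"]
      predist.subspace_diff[OF subspace_dist_relations, of "u - y" "x - y"] xy
    by auto
  then show "cls x = cls y"
    by (auto simp: mem_dist_class_iff)
qed

text \<open>
  All operations of the distribution module are given by representatives; with this lemma and
  the two after it every computation with classes becomes one in the free module.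
\<close>

lemma dist_lift_class:
  assumes add: "\<And>x y. h (x + y) = h x + h y" and Z: "\<And>z. z \<in> Z \<Longrightarrow> h z \<in> Z"
  shows "dist_lift der integ S h (cls x) = cls (h x)"
proof -
  have "cls (h u) = cls (h x)" if "u \<in> cls x" for u
  proof -
    have "h u - h x = h (u - x)"
      using add[of "u - x" x] by simp
    then show ?thesis
      using that Z by (simp add: mem_dist_class_iff dist_class_eq_iff)
  qed
  then show ?thesis
    using dist_class_self[of x] unfolding dist_lift_def by blast
qed

lemma add_dist_class: "add (dist_module der integ S) (cls x) (cls y) = cls (x + y)"
proof -
  have "cls (u + v) = cls (x + y)" if "u \<in> cls x" "v \<in> cls y" for u v
    using predist.subspace_add[OF subspace_dist_relations, of "u - x" "v - y"] that
    by (simp add: mem_dist_class_iff dist_class_eq_iff algebra_simps)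
  then have "(\<Union>u\<in>cls x. \<Union>v\<in>cls y. cls (u + v)) = (\<Union>u\<in>cls x. \<Union>v\<in>cls y. cls (x + y))"
    by (intro SUP_cong refl)
  also have "\<dots> = cls (x + y)"
    using dist_class_self[of x] dist_class_self[of y] by blast
  finally show ?thesis
    by (simp add: dist_module_def)
qed

lemma smult_dist_class: "f \<odot>\<^bsub>dist_module der integ S\<^esub> cls x = cls (predist_smult f x)"
  using dist_lift_class[of "predist_smult f" x]
  by (simp add: dist_module_def predist.scale_right_distrib
      predist.subspace_scale[OF subspace_dist_relations])

lemma carrier_dist_module: "carrier (dist_module der integ S) = range cls"
  by (simp add: dist_module_def)

lemma zero_dist_module: "\<zero>\<^bsub>dist_module der integ S\<^esub> = cls 0"
  by (simp add: dist_module_def)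

lemma dist_carrier_cases:
  assumes "A \<in> carrier (dist_module der integ S)"
  obtains x where "A = cls x"
  using assms by (auto simp: carrier_dist_module)

lemma dist_class_in_carrier: "cls x \<in> carrier (dist_module der integ S)"
  by (simp add: carrier_dist_module)

lemma abelian_group_dist_module: "abelian_group (dist_module der integ S)" (is "abelian_group ?M")
proof (rule abelian_groupI)
  fix A B C
  assume "A \<in> carrier ?M" "B \<in> carrier ?M" "C \<in> carrier ?M"
  then obtain x y z where xyz: "A = cls x" "B = cls y" "C = cls z"
    by (meson dist_carrier_cases)
  show "(A \<oplus>\<^bsub>?M\<^esub> B) \<oplus>\<^bsub>?M\<^esub> C = A \<oplus>\<^bsub>?M\<^esub> (B \<oplus>\<^bsub>?M\<^esub> C)"
    by (simp only: xyz add_dist_class add.assoc)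
next
  fix A B
  assume "A \<in> carrier ?M" "B \<in> carrier ?M"
  then obtain x y where xy: "A = cls x" "B = cls y"
    by (meson dist_carrier_cases)
  show "A \<oplus>\<^bsub>?M\<^esub> B \<in> carrier ?M"
    by (simp only: xy add_dist_class dist_class_in_carrier)
  show "A \<oplus>\<^bsub>?M\<^esub> B = B \<oplus>\<^bsub>?M\<^esub> A"
    by (simp only: xy add_dist_class add.commute)
next
  fix A
  assume "A \<in> carrier ?M"
  then obtain x where x: "A = cls x"
    by (rule dist_carrier_cases)
  show "\<zero>\<^bsub>?M\<^esub> \<oplus>\<^bsub>?M\<^esub> A = A"
    by (simp only: x add_dist_class zero_dist_module add_0)
  have "cls (- x) \<oplus>\<^bsub>?M\<^esub> A = \<zero>\<^bsub>?M\<^esub>"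
    by (simp only: x add_dist_class zero_dist_module ab_left_minus)
  then show "\<exists>B\<in>carrier ?M. B \<oplus>\<^bsub>?M\<^esub> A = \<zero>\<^bsub>?M\<^esub>"
    using dist_class_in_carrier by blast
qed (simp only: zero_dist_module dist_class_in_carrier)

lemma module_dist_module:
  "Module.module (ring_of_type_algebra :: 'f ring) (dist_module der integ S)"
  (is "Module.module ?R ?M")
proof (rule Module.moduleI)
  fix f g :: 'f and A B
  assume "A \<in> carrier ?M" "B \<in> carrier ?M"
  then obtain x y where xy: "A = cls x" "B = cls y"
    by (meson dist_carrier_cases)
  show "f \<odot>\<^bsub>?M\<^esub> (A \<oplus>\<^bsub>?M\<^esub> B) = f \<odot>\<^bsub>?M\<^esub> A \<oplus>\<^bsub>?M\<^esub> f \<odot>\<^bsub>?M\<^esub> B"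
    by (simp only: xy add_dist_class smult_dist_class predist.scale_right_distrib)
next
  fix f g :: 'f and A
  assume "A \<in> carrier ?M"
  then obtain x where x: "A = cls x"
    by (rule dist_carrier_cases)
  show "f \<odot>\<^bsub>?M\<^esub> A \<in> carrier ?M"
    by (simp only: x smult_dist_class dist_class_in_carrier)
  have "f \<oplus>\<^bsub>?R\<^esub> g = f + g" "f \<otimes>\<^bsub>?R\<^esub> g = f * g" "\<one>\<^bsub>?R\<^esub> = 1"
    by (simp_all add: ring_of_type_algebra_def)
  then show "(f \<oplus>\<^bsub>?R\<^esub> g) \<odot>\<^bsub>?M\<^esub> A = f \<odot>\<^bsub>?M\<^esub> A \<oplus>\<^bsub>?M\<^esub> g \<odot>\<^bsub>?M\<^esub> A"
    "(f \<otimes>\<^bsub>?R\<^esub> g) \<odot>\<^bsub>?M\<^esub> A = f \<odot>\<^bsub>?M\<^esub> (g \<odot>\<^bsub>?M\<^esub> A)"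
    "\<one>\<^bsub>?R\<^esub> \<odot>\<^bsub>?M\<^esub> A = A"
    by (simp_all only: x add_dist_class smult_dist_class predist.scale_left_distrib
        predist.scale_scale predist.scale_one)
qed (rule cring_from_type_algebra abelian_group_dist_module)+

lemma a_minus_dist_class:
  "cls x \<ominus>\<^bsub>dist_module der integ S\<^esub> cls y = cls (x - y)"
proof -
  interpret M: Module.module "ring_of_type_algebra :: 'f ring" "dist_module der integ S"
    by (rule module_dist_module)
  have "\<ominus>\<^bsub>dist_module der integ S\<^esub> cls y = cls (- y)"
  proof (rule M.minus_equality)
    show "cls (- y) \<oplus>\<^bsub>dist_module der integ S\<^esub> cls y = \<zero>\<^bsub>dist_module der integ S\<^esub>"
      by (simp only: add_dist_class zero_dist_module ab_left_minus)
  qed (simp_all only: carrier_dist_module rangeI)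
  then show ?thesis
    by (simp only: M.minus_eq add_dist_class diff_conv_add_uminus)
qed

end

section \<open>The derivation of the free module\<close>

context differential_algebra
begin

lemma scale_eq_mult: "scale c f = scale c 1 * f"
  using scale_mult[of c 1 f] by simp

lemma der_add: "der (f + g) = der f + der g"
  by (rule Vector_Spaces.linear.axioms(3)[OF linear_der, THEN module_hom.add])

lemma predist_der_single:
  "predist_der der (Poly_Mapping.single b f) = predist_der_term der b f"
proof -
  have "der 0 = 0"
    using der_add[of 0 0] by simp
  then have "predist_der_term der b 0 = 0"
    by (cases b) auto
  then show ?thesis
    unfolding predist_der_def by (rule sum_keys_single[where T = "predist_der_term der"])
qed

lemma predist_der_term_add:
  "predist_der_term der b (f + g) = predist_der_term der b f + predist_der_term der b g"
  by (cases b) (simp_all add: der_add single_add ac_simps)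

lemma predist_der_add: "predist_der der (x + y) = predist_der der x + predist_der der y"
  unfolding predist_der_def
  by (rule sum_keys_add[where T = "predist_der_term der"]) (rule predist_der_term_add)

lemma predist_der_smult:
  "predist_der der (predist_smult f x) =
   predist_smult (der f) x + predist_smult f (predist_der der x)"
proof (induction x rule: single_sum_induct)
  case (single b g)
  show ?case
    by (cases b) (auto simp: predist_der_single leibniz single_add algebra_simps predist.scale_right_distrib)
next
  case (add x y)
  then show ?case
    by (simp add: predist_der_add predist.scale_right_distrib algebra_simps)
qed

text \<open>
  In particular \<open>D\<close> preserves the submodule spanned by the deltas, that is, by the
  \<open>Hvs a k\<close> with \<open>k > 0\<close>: derivatives only feed into higher orders.
\<close>

lemma lookup_predist_der:
  "Poly_Mapping.lookup (predist_der der x) One = der (Poly_Mapping.lookup x One)"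
  "Poly_Mapping.lookup (predist_der der x) (Hvs a 0) = der (Poly_Mapping.lookup x (Hvs a 0))"
proof (induction x rule: single_sum_induct)
  case (single b g)
  have "der 0 = 0"
    using der_add[of 0 0] by simp
  then show "Poly_Mapping.lookup (predist_der der (Poly_Mapping.single b g)) One = 
      der (Poly_Mapping.lookup (Poly_Mapping.single b g) One)"
   "Poly_Mapping.lookup (predist_der der (Poly_Mapping.single b g)) (Hvs a 0) = 
      der (Poly_Mapping.lookup (Poly_Mapping.single b g) (Hvs a 0))"
    by (cases b; auto simp: predist_der_single lookup_add lookup_single when_def)+
qed (simp_all add: predist_der_add lookup_add der_add)

end

section \<open>Evaluation in an integro-differential algebra\<close>

context integro_differential_algebra
begin

lemma der_scalar: "der (scale c 1) = 0"
proof -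
  have "der (scale c 1) = scale c (der 1)"
    by (rule Vector_Spaces.linear.axioms(3)[OF linear_der, THEN module_hom.scale])
  moreover have "der 1 = 0"
    using leibniz[of 1 1] by simp
  ultimately show ?thesis
    by simp
qed

lemma integ_add: "integ (f + g) = integ f + integ g"
  by (rule Vector_Spaces.linear.axioms(3)[OF linear_integ, THEN module_hom.add])

lemma der_zero: "der 0 = 0" and integ_zero: "integ 0 = 0"
  using der_add[of 0 0] integ_add[of 0 0] by auto

lemma der_diff: "der (f - g) = der f - der g"
  using der_add[of "f - g" g] by simp

lemma integ_diff: "integ (f - g) = integ f - integ g"
  using integ_add[of "f - g" g] by simp

lemma integ_scalar_mult:
  assumes "der k = 0"
  shows "integ (k * f) = k * integ f"
  using integ_by_parts[of k f] assms by (simp add: integ_zero)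

lemma der_ev: "der (ev der integ f) = 0"
  by (simp add: ev_def der_diff der_integ)

lemma ev_scalar: "der k = 0 \<Longrightarrow> ev der integ k = k"
  by (simp add: ev_def integ_zero)

lemma ev_add: "ev der integ (f + g) = ev der integ f + ev der integ g"
  by (simp add: ev_def der_add integ_add)

lemma ev_integ: "ev der integ (integ f) = 0"
  by (simp add: ev_def der_integ)

text \<open>
  Integration by parts says that the image of the integral, which is the kernel of the evaluation,
  is an ideal.
\<close>

lemma ev_mult_integ: "ev der integ (f * integ g) = 0"
  unfolding ev_def leibniz der_integ integ_add using integ_by_parts[of f g] by simp

text \<open>
  Every \<open>g\<close> is the constant \<open>e(g)\<close> plus an integral. The integral part
  contributes nothing because the integrals form an ideal, and constants pass through the
  integral.
\<close>

lemma ev_mult: "ev der integ (f * g) = ev der integ f * ev der integ g"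
proof -
  have "ev der integ (f * g) = ev der integ (f * ev der integ g + f * integ (der g))"
    by (simp add: ev_def algebra_simps)
  also have "\<dots> = ev der integ (ev der integ g * f)"
    by (simp add: ev_add ev_mult_integ mult.commute)
  also have "\<dots> = ev der integ g * ev der integ f"
    using integ_scalar_mult[OF der_ev[of g], of "der f"]
    by (simp add: ev_def[of _ _ "_ * _"] ev_def[of _ _ f] leibniz der_ev algebra_simps)
  finally show ?thesis
    by (simp add: mult.commute)
qed

end

section \<open>The shifted evaluations\<close>

locale ordinary_shifted_integro_differential_algebra =
  ordinary_integro_differential_algebra scale der integ +
  shifted_integro_differential_algebra scale der integ S
  for scale :: "'k::linordered_field \<Rightarrow> 'f::comm_ring_1 \<Rightarrow> 'f"
    and der integ :: "'f \<Rightarrow> 'f" and S :: "'k \<Rightarrow> 'f \<Rightarrow> 'f"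
begin

abbreviation e :: "'f \<Rightarrow> 'f" where "e \<equiv> ev der integ"
abbreviation e_at :: "'k \<Rightarrow> 'f \<Rightarrow> 'f" where "e_at \<equiv> ev_at der integ S"
abbreviation Dp :: "('k, 'f) predist \<Rightarrow> ('k, 'f) predist" where "Dp \<equiv> predist_der der"
abbreviation Ip :: "('k, 'f) predist \<Rightarrow> ('k, 'f) predist"
  where "Ip \<equiv> predist_integ scale der integ S"
abbreviation Rel :: "('k, 'f) predist set" where "Rel \<equiv> dist_relations der integ S"
abbreviation cl :: "('k, 'f) predist \<Rightarrow> ('k, 'f) predist set"
  where "cl \<equiv> dist_class der integ S"
abbreviation Hbar :: "'k \<Rightarrow> 'f" where "Hbar a \<equiv> scale (heaviside_bar a) 1"

lemma shift_one: "S c 1 = 1"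
  and shift_plus: "S c (f + g) = S c f + S c g"
  and shift_mult: "S c (f * g) = S c f * S c g"
  and shift_scale: "S c (scale k f) = scale k (S c f)"
  using aut_shift[of c] Vector_Spaces.linear.axioms(3)[THEN module_hom.add, of scale scale "S c"]
    Vector_Spaces.linear.axioms(3)[THEN module_hom.scale, of scale scale "S c"]
  by (auto simp: algebra_aut_def)

lemma shift_zero: "S 0 f = f"
proof -
  have "inj (S 0)"
    using aut_shift[of 0] by (auto simp: algebra_aut_def bij_def)
  moreover have "S 0 (S 0 f) = S 0 f"
    using shift_add[of 0 0] by (simp add: fun_eq_iff)
  ultimately show ?thesis
    by (simp add: inj_eq)
qed

lemma shift_scalar:
  assumes "der k = 0"
  shows "S c k = k"
proof -
  obtain r where "k = scale r 1"
    using assms kernel_der by blast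
  then show ?thesis
    by (simp add: shift_scale shift_one)
qed

lemma e_at_add: "e_at c (f + g) = e_at c f + e_at c g"
  by (simp add: ev_at_def shift_plus ev_add)

lemma e_at_diff: "e_at c (f - g) = e_at c f - e_at c g"
  using e_at_add[of c "f - g" g] by simp

lemma e_at_mult: "e_at c (f * g) = e_at c f * e_at c g"
  by (simp add: ev_at_def shift_mult ev_mult)

lemma der_e_at: "der (e_at c f) = 0"
  by (simp add: ev_at_def der_ev)

lemma e_at_scalar: "der k = 0 \<Longrightarrow> e_at c k = k"
  by (simp add: ev_at_def shift_scalar ev_scalar)

lemma e_at_0: "e_at 0 f = e f"
  by (simp add: ev_at_def shift_zero)

lemma integ_from_der: "integ_from der integ S a (der f) = f - e_at a f"
proof -
  have "integ (der f) = f - e f"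
    by (simp add: ev_def)
  then show ?thesis
    by (simp add: integ_from_def e_at_diff e_at_scalar der_ev)
qed

lemma der_integ_from: "der (integ_from der integ S a f) = f"
  by (simp add: integ_from_def der_diff der_e_at der_integ)

text \<open>
  This is what makes \<open>D I = 1\<close> true on \<open>f H\<^sub>a\<close>: the Leibniz rule leaves the stray term
  \<open>(\<integral>\<^sub>a f) \<delta>\<^sub>a\<close>, which the relations replace by the value of \<open>\<integral>\<^sub>a f\<close> at \<open>a\<close>.
\<close>

lemma e_at_integ_from: "e_at a (integ_from der integ S a f) = 0"
  by (simp add: integ_from_def e_at_diff e_at_scalar der_e_at)

lemma integ_from_add:
  "integ_from der integ S a (f + g) = integ_from der integ S a f + integ_from der integ S a g"
  by (simp add: integ_from_def integ_add e_at_add)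

lemma integ_from_scalar_mult:
  "der k = 0 \<Longrightarrow> integ_from der integ S a (k * f) = k * integ_from der integ S a f"
  by (simp add: integ_from_def integ_scalar_mult e_at_mult e_at_scalar right_diff_distrib)

section \<open>The integral and the boundary operator of the free module\<close>

lemma integ_delta_add:
  "predist_integ_delta scale der integ S a k (f + g) =
   predist_integ_delta scale der integ S a k f + predist_integ_delta scale der integ S a k g"
  by (induction k arbitrary: f g)
    (simp_all add: e_at_add der_add single_add predist.scale_left_distrib algebra_simps
      del: predist_smult_single)

lemma integ_delta_scalar_mult:
  assumes "der c = 0"
  shows "predist_integ_delta scale der integ S a k (c * f) =
   predist_smult c (predist_integ_delta scale der integ S a k f)"
  using assms by (induction k arbitrary: f)
    (simp_all add: e_at_mult e_at_scalar leibniz predist.scale_right_diff_distrib mult.assoc)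

lemma integ_term_add:
  "predist_integ_term scale der integ S b (f + g) =
   predist_integ_term scale der integ S b f + predist_integ_term scale der integ S b g"
proof (cases b)
  case (Hvs a k)
  then show ?thesis
    by (cases k)
      (simp_all add: integ_from_add integ_from_to_def e_at_add scale_right_distrib single_add
        integ_delta_add add_ac)
qed (simp add: integ_add single_add)

lemma integ_add_predist: "Ip (x + y) = Ip x + Ip y"
  unfolding predist_integ_def
  by (rule sum_keys_add[where T = "predist_integ_term scale der integ S"]) (rule integ_term_add)

lemma integ_zero_predist: "Ip 0 = 0"
  by (simp add: predist_integ_def)

lemma integ_diff_predist: "Ip (x - y) = Ip x - Ip y"
  using integ_add_predist[of "x - y" y] by simp

lemma integ_single: "Ip (Poly_Mapping.single b f) = predist_integ_term scale der integ S b f"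
  unfolding predist_integ_def
  by (rule sum_keys_single[where T = "predist_integ_term scale der integ S"])
    (use integ_term_add[of b 0 0] in simp)

text \<open>
  Constants are the scalars of the ground field, so this is linearity of the integral.
\<close>

lemma integ_predist_scalar_mult:
  assumes "der c = 0"
  shows "Ip (predist_smult c x) = predist_smult c (Ip x)"
proof (induction x rule: single_sum_induct)
  case (single b f)
  show ?case
  proof (cases b)
    case (Hvs a k)
    then show ?thesis
      using assms by (cases k)
        (simp_all add: integ_single integ_from_scalar_mult integ_from_to_def e_at_mult e_at_scalar
          integ_delta_scalar_mult predist.scale_right_distrib scale_eq_mult[of _ "_ * _"]
          scale_eq_mult[of _ "e_at _ _"] mult.left_commute)
  qed (use assms in \<open>simp add: integ_single integ_scalar_mult\<close>)
qed (simp add: integ_add_predist predist.scale_right_distrib)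

definition boundary :: "('k, 'f) predist \<Rightarrow> ('k, 'f) predist" where
  "boundary x = x - Ip (Dp x)"

text \<open>
  The number \<open>H\<^sub>a(0)\<close> is \<open>1\<close> for \<open>a \<le> 0\<close> and \<open>0\<close> for \<open>a > 0\<close>, which is \<open>1 - H(a)\<close>; in
  particular the convention is \<open>H\<^sub>0(0) = 1\<close>.
\<close>

fun basis_value_at_0 :: "'k dist_basis \<Rightarrow> 'f" where
  "basis_value_at_0 One = 1"
| "basis_value_at_0 (Hvs a 0) = Hbar a"
| "basis_value_at_0 (Hvs a (Suc k)) = 0"

lemma der_basis_value_at_0: "der (basis_value_at_0 b) = 0"
  by (cases b rule: basis_value_at_0.cases) (use der_scalar[of 1] in \<open>auto simp: der_scalar der_zero\<close>)

lemma boundary_add: "boundary (x + y) = boundary x + boundary y"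
  by (simp add: boundary_def predist_der_add integ_add_predist)

text \<open>
  For \<open>f H\<^sub>a\<close> the integral of \<open>f' H\<^sub>a + f \<delta>\<^sub>a\<close> is
  \<open>(f - f(a)) H\<^sub>a + H\<^sub>a(0) (f(a) - f(0)) + f(a) (H\<^sub>a - H\<^sub>a(0))\<close>, where the values at \<open>a\<close> cancel
  and \<open>f H\<^sub>a - H\<^sub>a(0) f(0)\<close> remains. For deltas the recursion that defines \<open>I\<close> is exactly
  the statement \<open>I D = 1\<close>.
\<close>

lemma boundary_single:
  "boundary (Poly_Mapping.single b f) = Poly_Mapping.single One (basis_value_at_0 b * e f)"
proof (cases b rule: basis_value_at_0.cases)
  case 1
  then show ?thesis
    by (simp add: boundary_def predist_der_single integ_single ev_def single_diff)
next
  case (2 a)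
  have e: "e f = f - integ (der f)"
    by (simp add: ev_def)
  have "e_at a (integ (der f)) = e_at a f - e f"
    using e_at_diff[of a f "integ (der f)"] by (simp flip: e add: e_at_scalar der_ev)
  then show ?thesis
    using 2
    by (simp add: boundary_def predist_der_single integ_add_predist integ_single integ_from_der
        integ_from_to_def e_at_0 e_at_diff e_at_scalar der_e_at single_diff
        predist.scale_right_diff_distrib scale_eq_mult[of _ "_ - _"] der_ev algebra_simps)
next
  case (3 a k)
  then show ?thesis
    by (simp add: boundary_def predist_der_single integ_add_predist integ_single)
qed

lemma boundary_smult: "boundary (predist_smult g x) = predist_smult (e g) (boundary x)"
  by (induction x rule: single_sum_induct)
    (simp_all add: boundary_add boundary_single ev_mult predist.scale_right_distrib mult_ac)

lemma boundary_scalar: "\<exists>c. boundary x = Poly_Mapping.single One (scale c 1)"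
proof (induction x rule: single_sum_induct)
  case (single b f)
  have "der (basis_value_at_0 b * e f) = 0"
    by (simp add: leibniz der_basis_value_at_0 der_ev)
  then have "basis_value_at_0 b * e f \<in> range (\<lambda>c. scale c 1)"
    using kernel_der by auto
  then show ?case
    by (auto simp: boundary_single)
next
  case (add x y)
  then show ?case
    by (metis boundary_add single_add scale_left_distrib)
qed

text \<open>
  The boundary only sees the coefficients of \<open>1\<close> and of the Heaviside functions themselves.
\<close>

lemma boundary_eq_0:
  assumes "Poly_Mapping.lookup x One = 0" and "\<And>a. Poly_Mapping.lookup x (Hvs a 0) = 0"
  shows "boundary x = 0"
proof -
  have "boundary x = Poly_Mapping.single One
      (\<Sum>b\<in>Poly_Mapping.keys x. basis_value_at_0 b * e (Poly_Mapping.lookup x b))"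
    for x
  proof (induction x rule: single_sum_induct)
    case (single b f)
    show ?case
      by (simp add: boundary_single sum_keys_single[of "\<lambda>b f. basis_value_at_0 b * e f"] ev_scalar der_zero)
  next
    case (add x y)
    then show ?case
      by (simp add: boundary_add single_add ev_add distrib_left
          sum_keys_add[of "\<lambda>b f. basis_value_at_0 b * e f"])
  qed
  moreover have "basis_value_at_0 b * e (Poly_Mapping.lookup x b) = 0" for b
    using assms by (cases b rule: basis_value_at_0.cases) (auto simp: ev_scalar der_zero)
  ultimately show ?thesis
    by simp
qed

section \<open>Integration respects the relations\<close>

lemma der_relations: "x \<in> Rel \<Longrightarrow> Dp x \<in> Rel"
  using dist_relations_closed by blast

lemma delta_relation:
  "Poly_Mapping.single (Hvs a 1) f - Poly_Mapping.single (Hvs a 1) (e_at a f) \<in> Rel"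
  unfolding dist_relations_def by (rule hull_inc) blast

lemma integ_relations:
  assumes "z \<in> Rel"
  shows "Ip z \<in> Rel"
proof -
  note sub = subspace_dist_relations[of der integ S]
  \<comment> \<open>Claiming only \<open>Ip z \<in> Rel\<close> would not survive the step from \<open>z\<close> to \<open>D z\<close>: integration by
    parts needs all multiples of \<open>z\<close>, and the vanishing of the boundary needs that \<open>z\<close> involves
    deltas only.\<close>
  define J where "J = {z \<in> Rel. Poly_Mapping.lookup z One = 0 \<and>
    (\<forall>a. Poly_Mapping.lookup z (Hvs a 0) = 0) \<and> (\<forall>g. Ip (predist_smult g z) \<in> Rel)}"
  have "predist.subspace J"
    unfolding predist.subspace_def J_def using sub
    by (auto simp: predist.subspace_0 predist.subspace_add predist.subspace_scale
        integ_zero_predist integ_add_predist lookup_add predist.scale_right_distrib)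
  moreover have "Dp z \<in> J" if z: "z \<in> J" for z
  proof -
    have "Ip (predist_smult g (Dp z)) \<in> Rel" for g
    proof -
      have "boundary (predist_smult g z) = 0"
        using z by (intro boundary_eq_0) (auto simp: J_def)
      then have "Ip (predist_smult g (Dp z)) =
          predist_smult g z - Ip (predist_smult (der g) z)"
        by (simp add: boundary_def predist_der_smult integ_add_predist algebra_simps)
      then show ?thesis
        using z sub by (simp add: J_def predist.subspace_diff predist.subspace_scale)
    qed
    then show ?thesis
      using z by (auto simp: J_def der_relations lookup_predist_der der_zero)
  qed
  moreover have "Poly_Mapping.single (Hvs a 1) f - Poly_Mapping.single (Hvs a 1) (e_at a f) \<in> J"
    for f a
  proof -
    \<comment> \<open>the integral of \<open>f \<delta>\<^sub>a\<close> depends only on \<open>f(a)\<close>\<close>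
    have "Ip (predist_smult g (Poly_Mapping.single (Hvs a 1) f -
        Poly_Mapping.single (Hvs a 1) (e_at a f))) = 0" for g
      by (simp add: predist.scale_right_diff_distrib integ_diff_predist integ_single e_at_mult
          e_at_scalar der_e_at)
    then show ?thesis
      using delta_relation[of a f] predist.subspace_0[OF sub]
      by (simp add: J_def lookup_minus lookup_single)
  qed
  ultimately have "Rel \<subseteq> J"
    unfolding dist_relations_def by (intro hull_minimal) auto
  with assms have "Ip (predist_smult 1 z) \<in> Rel"
    unfolding J_def by blast
  then show ?thesis
    by simp
qed

section \<open>The integral is a section of the derivation\<close>

lemma der_diff_predist: "Dp (x - y) = Dp x - Dp y"
  using predist_der_add[of "x - y" y] by simp

text \<open>
  By the recursion for \<open>I\<close>, differentiating \<open>I (f \<delta>\<^sub>a\<^sup>(\<^sup>k\<^sup>+\<^sup>1\<^sup>))\<close> gives the right term plus the defect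
  \<open>f' \<delta>\<^sub>a\<^sup>(\<^sup>k\<^sup>) - D I (f' \<delta>\<^sub>a\<^sup>(\<^sup>k\<^sup>))\<close> of one order less, so by induction the only source of defects
  is \<open>f \<delta>\<^sub>a - f(a) \<delta>\<^sub>a\<close>, a generating relation.
\<close>

lemma der_integ_delta:
  "Dp (predist_integ_delta scale der integ S a k f) - Poly_Mapping.single (Hvs a (Suc k)) f \<in> Rel"
proof (induction k arbitrary: f)
  case 0
  have "Dp (predist_integ_delta scale der integ S a 0 f) =
      Poly_Mapping.single (Hvs a 1) (e_at a f)"
    by (simp add: predist.scale_right_diff_distrib der_diff_predist predist_der_single leibniz
        der_e_at der_scalar)
  then show ?case
    using predist.subspace_neg[OF subspace_dist_relations delta_relation[of a f]] by simp
next
  case (Suc k)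
  have "Dp (predist_integ_delta scale der integ S a (Suc k) f) -
      Poly_Mapping.single (Hvs a (Suc (Suc k))) f =
      - (Dp (predist_integ_delta scale der integ S a k (der f)) -
         Poly_Mapping.single (Hvs a (Suc k)) (der f))"
    by (simp add: der_diff_predist predist_der_single)
  then show ?case
    using predist.subspace_neg[OF subspace_dist_relations Suc.IH[of "der f"]] by simp
qed

lemma der_integ_predist: "Dp (Ip x) - x \<in> Rel"
proof (induction x rule: single_sum_induct)
  case (single b f)
  show ?case
  proof (cases b rule: basis_value_at_0.cases)
    case 1
    then show ?thesis
      using predist.subspace_0[OF subspace_dist_relations]
      by (simp add: integ_single predist_der_single der_integ)
  next
    case (2 a)
    have "der (scale (heaviside_bar a) (integ_from_to der integ S 0 a f)) = 0"
      by (subst scale_eq_mult) (simp add: leibniz der_scalar integ_from_to_def der_e_at)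
    then show ?thesis
      using 2 delta_relation[of a "integ_from der integ S a f"]
      by (simp add: integ_single predist_der_add predist_der_single der_integ_from
          e_at_integ_from)
  next
    case (3 a k)
    then show ?thesis
      using der_integ_delta by (simp add: integ_single)
  qed
next
  case (add x y)
  have "Dp (Ip (x + y)) - (x + y) = (Dp (Ip x) - x) + (Dp (Ip y) - y)"
    by (simp add: predist_der_add integ_add_predist)
  then show ?case
    using predist.subspace_add[OF subspace_dist_relations add] by (simp only:)
qed

section \<open>The distribution module\<close>

lemma dist_der_class: "dist_der der integ S (cl x) = cl (Dp x)"
  unfolding dist_der_def by (intro dist_lift_class predist_der_add der_relations)

lemma dist_integ_class: "dist_integ scale der integ S (cl x) = cl (Ip x)"
  unfolding dist_integ_def by (intro dist_lift_class integ_add_predist integ_relations)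

lemma der_integ_class: "cl (Dp (Ip x)) = cl x"
  using der_integ_predist by (simp add: dist_class_eq_iff)

text \<open>
  An element that both \<open>D\<close> and the boundary operator send to relations is itself a relation, as
  \<open>x = B x + I D x\<close>; the difference of the two sides is of this kind.
\<close>

lemma rota_baxter_predist:
  "predist_smult (integ f) (Ip x) -
   (Ip (predist_smult f (Ip x)) + Ip (predist_smult (integ f) x)) \<in> Rel" (is "?d \<in> Rel")
proof -
  have bI: "boundary (Ip y) \<in> Rel" for y
  proof -
    have "boundary (Ip y) = - Ip (Dp (Ip y) - y)"
      by (simp add: boundary_def integ_diff_predist)
    then show ?thesis
      using predist.subspace_neg[OF subspace_dist_relations
          integ_relations[OF der_integ_predist[of y]]] by simp
  qed
  have bd: "boundary (x - y) = boundary x - boundary y" for x y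
    using boundary_add[of "x - y" y] by simp
  have "boundary ?d = - (boundary (Ip (predist_smult f (Ip x))) +
      boundary (Ip (predist_smult (integ f) x)))"
    by (simp add: bd boundary_add boundary_smult ev_integ)
  then have b: "boundary ?d \<in> Rel"
    using predist.subspace_neg[OF subspace_dist_relations
        predist.subspace_add[OF subspace_dist_relations bI bI]] by simp
  have "Dp ?d = predist_smult (integ f) (Dp (Ip x) - x)
      - (Dp (Ip (predist_smult f (Ip x))) - predist_smult f (Ip x))
      - (Dp (Ip (predist_smult (integ f) x)) - predist_smult (integ f) x)"
    by (simp add: der_diff_predist predist_der_add predist_der_smult der_integ
        predist.scale_right_diff_distrib)
  then have "Dp ?d \<in> Rel"
    by (simp only:) (intro predist.subspace_diff subspace_dist_relations predist.subspace_scale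
        der_integ_predist)
  then have "boundary ?d + Ip (Dp ?d) \<in> Rel"
    by (intro predist.subspace_add subspace_dist_relations b integ_relations)
  then show ?thesis
    by (simp add: boundary_def)
qed

lemma rota_baxter_class:
  "cl (Ip (predist_smult f (Ip x)) + Ip (predist_smult (integ f) x)) =
   cl (predist_smult (integ f) (Ip x))"
  using rota_baxter_predist[of f x] dist_class_eq_iff by metis

lemma integro_differential_dist_module:
  "integro_differential_module scale der integ
    (dist_module der integ S) (dist_der der integ S) (dist_integ scale der integ S)"
proof -
  let ?M = "dist_module der integ S"
  interpret M: Module.module "ring_of_type_algebra :: 'f ring" ?M
    by (rule module_dist_module)
  have "differential_rota_baxter_module_axioms scale der integ ?M
      (dist_der der integ S) (dist_integ scale der integ S)"
    by unfold_locales
     (auto simp: carrier_dist_module add_dist_class smult_dist_class dist_der_class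
        dist_integ_class predist_der_add integ_add_predist predist_der_smult der_scalar
        integ_predist_scalar_mult rota_baxter_class der_integ_class)
  then interpret RB: differential_rota_baxter_module scale der integ ?M
    "dist_der der integ S" "dist_integ scale der integ S"
    by (intro differential_rota_baxter_module.intro M.module_axioms integro_differential_algebra_axioms)
  have E: "RB.E (cl x) = cl (boundary x)" for x
    by (simp only: RB.E_def dist_der_class dist_integ_class a_minus_dist_class boundary_def)
  show ?thesis
    by unfold_locales (auto simp: carrier_dist_module smult_dist_class E boundary_smult)
qed

text \<open>
  If \<open>D x\<close> is a relation, then so is \<open>I D x\<close>, and \<open>x\<close> is represented by the scalar \<open>B x\<close>.
\<close>

lemma kernel_dist_der:
  "{\<phi> \<in> carrier (dist_module der integ S). dist_der der integ S \<phi> =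
     \<zero>\<^bsub>dist_module der integ S\<^esub>} = range (\<lambda>c. dist_of der integ S (scale c 1))"
proof (intro equalityI subsetI)
  fix \<phi> assume "\<phi> \<in> {\<phi> \<in> carrier (dist_module der integ S). dist_der der integ S \<phi> =
     \<zero>\<^bsub>dist_module der integ S\<^esub>}"
  then obtain x where x: "\<phi> = cl x" and "cl (Dp x) = cl 0"
    by (auto simp: carrier_dist_module dist_der_class zero_dist_module)
  then have "x - boundary x \<in> Rel"
    by (simp add: boundary_def integ_relations dist_class_eq_iff)
  moreover obtain c where "boundary x = Poly_Mapping.single One (scale c 1)"
    using boundary_scalar by blast
  ultimately have "\<phi> = dist_of der integ S (scale c 1)"
    using x by (simp add: dist_of_def dist_class_eq_iff)
  then show "\<phi> \<in> range (\<lambda>c. dist_of der integ S (scale c 1))"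
    by blast
next
  fix \<phi> assume "\<phi> \<in> range (\<lambda>c. dist_of der integ S (scale c 1))"
  then show "\<phi> \<in> {\<phi> \<in> carrier (dist_module der integ S). dist_der der integ S \<phi> =
     \<zero>\<^bsub>dist_module der integ S\<^esub>}"
    by (auto simp: dist_of_def carrier_dist_module dist_der_class zero_dist_module
        predist_der_single der_scalar)
qed

end

theorem proposition15:
  fixes scale :: "'k::linordered_field \<Rightarrow> 'f::comm_ring_1 \<Rightarrow> 'f"
    and der integ :: "'f \<Rightarrow> 'f"
    and S :: "'k \<Rightarrow> 'f \<Rightarrow> 'f"
  assumes "ordinary_integro_differential_algebra scale der integ"
    and "shifted_integro_differential_algebra scale der integ S"
  shows "ordinary_integro_differential_module scale der integ
    (dist_module der integ S) (dist_der der integ S) (dist_integ scale der integ S)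
    (\<lambda>c. dist_of der integ S (scale c 1))"
proof -
  interpret ordinary_shifted_integro_differential_algebra scale der integ S
    using assms by (rule ordinary_shifted_integro_differential_algebra.intro)
  show ?thesis
    by (intro ordinary_integro_differential_module.intro integro_differential_dist_module
        ordinary_integro_differential_module_axioms.intro kernel_dist_der)
qed

end
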